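(* Let $m,n\ge 1$ be integers, let $K$ be a connected component of the Farey complex $CF(m,n)$, and let $(A_k)_{k\in\mathbb{Z}}$ be a direct convex polygonal family (CPD) with $N$ vertices such that the boundary of $K$ is $\bigcup_{0\le k\le N-1}[A_k,A_{k+1}]$. (1) If there are two consecutive sides $\overrightarrow{A_{k-1}A_k}$, $\overrightarrow{A_kA_{k+1}}$ that lie in two opposite quadrants (one in $Q_1$ and the other in $Q_3$, or one in $Q_2$ and the other in $Q_4$), then $N=3$, i.e. the boundary of $K$ is a triangle. (2) Otherwise $N=4$, i.e. the boundary of $K$ is a quadrilateral, and there exists an integer $p$ such that for each $i\in\{1,2,3,4\}$ the vector $\overrightarrow{A_{p+i-1}A_{p+i}}$ is in the quadrant $Q_i$.
   Context: For integers $m,n\ge 1$, $D_{m,n}$ is the set of lines in $\mathbb{R}^2$ that meet the unit square $CU=[0,1]^2$ and admit an equation $ux+vy-w=0$ with $u,v,w\in\mathbb{Z}$, $-m\le u\le m$, $-n\le v\le n$, $(u,v)\ne(0,0)$. The Farey complex $CF(m,n)$ is the complement in $CU$ of the union of all lines of $D_{m,n}$. For vectors $V=(a,b)$ and $W=(c,d)$, $\det(V,W)=ad-bc$. Quadrants (as sets of nonzero vectors $(x,y)$): $Q_1=\{x\ge 0,\ y\ge 0\}$, $Q_2=\{x\le 0,\ y\ge 0\}$, $Q_3=\{x\le 0,\ y\le 0\}$, $Q_4=\{x\ge 0,\ y\le 0\}$. They are closed, so a nonzero vector on a coordinate axis belongs to two quadrants. Direct convex polygonal family (CPD) with $N$ vertices,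 $N\ge 3$: a family $(A_k)_{k\in\mathbb{Z}}$ of points of the plane such that (1) $A_{p+N}=A_p$ for all $p\in\mathbb{Z}$; (2) for all $p\in\{0,\dots,N-1\}$ and all $q\in\{1,\dots,N-1\}\setminus\{p,p+1\}$, $\det(\overrightarrow{A_pA_{p+1}},\overrightarrow{A_pA_q})>0$. The closure of each connected component $K$ of $CF(m,n)$ is a convex polygon, and there always exists a CPD whose polygonal line $\bigcup_k[A_k,A_{k+1}]$ is the boundary of $K$. *)

theory Defs
  imports "HOL-Analysis.Analysis"
begin

type_synonym plane = "real \<times> real"

definition unit_square :: "plane set" where
  "unit_square = {0..1} \<times> {0..1}"

definition line_eq :: "int \<Rightarrow> int \<Rightarrow> int \<Rightarrow> plane set" where
  "line_eq u v w = {(x, y). of_int u * x + of_int v * y - of_int w = 0}"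

definition farey_lines :: "int \<Rightarrow> int \<Rightarrow> plane set set" where
  "farey_lines m n =
     {L. L \<inter> unit_square \<noteq> {} \<and>
         (\<exists>u v w. - m \<le> u \<and> u \<le> m \<and> - n \<le> v \<and> v \<le> n \<and> (u, v) \<noteq> (0, 0) \<and>
                  L = line_eq u v w)}"

definition farey_complex :: "int \<Rightarrow> int \<Rightarrow> plane set" where
  "farey_complex m n = unit_square - \<Union> (farey_lines m n)"

definition det2 :: "plane \<Rightarrow> plane \<Rightarrow> real" where
  "det2 V W = fst V * snd W - snd V * fst W"

(* Quadrants are closed, so consecutive ones overlap on a half-axis.
   Only the indices 1, 2, 3, 4 are meaningful. *)
definition quadrant :: "int \<Rightarrow> plane set" where
  "quadrant i = {V. V \<noteq> (0, 0) \<and>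
     (i = 1 \<and> fst V \<ge> 0 \<and> snd V \<ge> 0 \<or>
      i = 2 \<and> fst V \<le> 0 \<and> snd V \<ge> 0 \<or>
      i = 3 \<and> fst V \<le> 0 \<and> snd V \<le> 0 \<or>
      i = 4 \<and> fst V \<ge> 0 \<and> snd V \<le> 0)}"

definition opposite_quadrants :: "plane \<Rightarrow> plane \<Rightarrow> bool" where
  "opposite_quadrants V W \<longleftrightarrow>
     V \<in> quadrant 1 \<and> W \<in> quadrant 3 \<or> V \<in> quadrant 3 \<and> W \<in> quadrant 1 \<or>
     V \<in> quadrant 2 \<and> W \<in> quadrant 4 \<or> V \<in> quadrant 4 \<and> W \<in> quadrant 2"

definition CPD :: "int \<Rightarrow> (int \<Rightarrow> plane) \<Rightarrow> bool" where
  "CPD N A \<longleftrightarrow> N \<ge> 3 \<and> (\<forall>p. A (p + N) = A p) \<and>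
     (\<forall>p\<in>{0..N-1}. \<forall>q\<in>{1..N-1} - {p, p + 1}.
        det2 (A (p + 1) - A p) (A q - A p) > 0)"

end

theory Submission
  imports Defs
begin

text \<open>
  Every side of \<open>K\<close> lies on a Farey line \<open>l = 0\<close> with \<open>l > 0\<close> on \<open>K\<close>. If two sides, with forms
  \<open>l\<close> and \<open>l'\<close>, had directions in the same closed quadrant, the normals would lie in a common
  quadrant too, so the coefficients of \<open>l - l'\<close> would again be bounded by \<open>m\<close> and \<open>n\<close>, and
  \<open>l - l'\<close> could not vanish on \<open>K\<close>. But \<open>l - l'\<close> is negative inside the first side and positive
  inside the second. Hence distinct sides never share a quadrant, so \<open>N \<le> 4\<close>; the rest is a
  finite analysis, in which positivity of the determinants of consecutive sides fixes the order.
\<close>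

section \<open>Integer affine forms and finiteness of the Farey lines\<close>

definition affine_form :: "int \<Rightarrow> int \<Rightarrow> int \<Rightarrow> plane \<Rightarrow> real" where
  "affine_form u v w z = of_int u * fst z + of_int v * snd z - of_int w"

text \<open>The condition of meeting the unit square is left out: it is automatic as soon as the
  form vanishes at a point of the square, and without it differences of forms are easy to
  test.\<close>

definition bounded_normal :: "int \<Rightarrow> int \<Rightarrow> int \<Rightarrow> int \<Rightarrow> bool" where
  "bounded_normal m n u v \<longleftrightarrow> \<bar>u\<bar> \<le> m \<and> \<bar>v\<bar> \<le> n \<and> (u, v) \<noteq> (0, 0)"

lemma continuous_on_affine_form [continuous_intros]: "continuous_on S (affine_form u v w)"
  unfolding affine_form_def by (intro continuous_intros)

lemma line_eq_affine_form: "line_eq u v w = {z. affine_form u v w z = 0}"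
  by (auto simp: line_eq_def affine_form_def)

lemma closed_line_eq: "closed (line_eq u v w)"
  unfolding line_eq_affine_form
  by (intro closed_Collect_eq continuous_on_affine_form continuous_on_const)

lemma line_eq_in_farey_lines:
  assumes "bounded_normal m n u v" "z \<in> unit_square" "affine_form u v w z = 0"
  shows "line_eq u v w \<in> farey_lines m n"
proof -
  have "line_eq u v w \<inter> unit_square \<noteq> {}"
    using assms(2,3) unfolding line_eq_affine_form by blast
  moreover have "- m \<le> u" "u \<le> m" "- n \<le> v" "v \<le> n" "(u, v) \<noteq> (0, 0)"
    using assms(1) by (auto simp: bounded_normal_def abs_le_iff)
  ultimately show ?thesis
    unfolding farey_lines_def by blast
qed

text \<open>At a point of the line inside the square both coordinates have absolute value at most 1,
  which bounds the constant term by \<open>\<bar>u\<bar> + \<bar>v\<bar>\<close>. This bound leaves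
  only finitely many triples of coefficients.\<close>

lemma farey_linesE:
  assumes "L \<in> farey_lines m n"
  obtains u v w where "bounded_normal m n u v" "\<bar>w\<bar> \<le> m + n" "L = line_eq u v w"
proof -
  obtain u v w z where uv: "bounded_normal m n u v" and L: "L = line_eq u v w"
    and z: "z \<in> unit_square" "affine_form u v w z = 0"
  proof -
    obtain u v w where "L \<inter> unit_square \<noteq> {}" and L: "L = line_eq u v w"
      and b: "- m \<le> u" "u \<le> m" "- n \<le> v" "v \<le> n" "(u, v) \<noteq> (0, 0)"
      using assms unfolding farey_lines_def by blast
    then obtain z where "z \<in> unit_square" "affine_form u v w z = 0"
      unfolding line_eq_affine_form by blast
    moreover have "bounded_normal m n u v"
      using b by (simp add: bounded_normal_def abs_le_iff)
    ultimately show thesis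
      using that L by blast
  qed
  have "\<bar>of_int u * fst z\<bar> \<le> \<bar>of_int u :: real\<bar> * 1" "\<bar>of_int v * snd z\<bar> \<le> \<bar>of_int v :: real\<bar> * 1"
    unfolding abs_mult using z(1) by (intro mult_left_mono; auto simp: unit_square_def)+
  then have "\<bar>of_int w :: real\<bar> \<le> of_int (\<bar>u\<bar> + \<bar>v\<bar>)"
    using z(2) by (simp add: affine_form_def)
  then have "\<bar>w\<bar> \<le> \<bar>u\<bar> + \<bar>v\<bar>"
    by linarith
  then show thesis
    using that[OF uv _ L] uv by (simp add: bounded_normal_def)
qed

lemma finite_farey_lines: "finite (farey_lines m n)"
proof (rule finite_subset)
  show "farey_lines m n \<subseteq> (\<lambda>(u, v, w). line_eq u v w) ` ({-m..m} \<times> {-n..n} \<times> {-(m+n)..m+n})"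
  proof
    fix L assume "L \<in> farey_lines m n"
    then obtain u v w where "bounded_normal m n u v" "\<bar>w\<bar> \<le> m + n" "L = line_eq u v w"
      by (rule farey_linesE)
    then show "L \<in> (\<lambda>(u, v, w). line_eq u v w) ` ({-m..m} \<times> {-n..n} \<times> {-(m+n)..m+n})"
      by (intro image_eqI[of _ _ "(u, v, w)"]) (auto simp: bounded_normal_def)
  qed
qed auto

section \<open>Signs of bounded forms on a component\<close>

lemma affine_form_nonzero_on_component:
  assumes "K \<in> components (farey_complex m n)" "bounded_normal m n u v" "z \<in> K"
  shows "affine_form u v w z \<noteq> 0"
proof
  assume 0: "affine_form u v w z = 0"
  have "z \<in> farey_complex m n"
    using assms in_components_subset by blast
  then show False
    using line_eq_in_farey_lines[OF assms(2) _ 0] 0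
    by (auto simp: farey_complex_def line_eq_affine_form)
qed

text \<open>The image of the connected set \<open>K\<close> is an interval that avoids 0, so the
  form keeps one sign on \<open>K\<close>; the weak inequality survives passage to the
  closure.\<close>

lemma affine_form_sign_on_closure:
  assumes K: "K \<in> components (farey_complex m n)" and uv: "bounded_normal m n u v"
  shows "(\<forall>z\<in>closure K. affine_form u v w z \<ge> 0) \<or> (\<forall>z\<in>closure K. affine_form u v w z \<le> 0)"
proof -
  have nz: "0 \<notin> affine_form u v w ` K"
    using affine_form_nonzero_on_component[OF K uv] by force
  have "connected (affine_form u v w ` K)"
    using in_components_connected[OF K] by (intro connected_continuous_image continuous_intros)
  then have "(\<forall>z\<in>K. affine_form u v w z \<ge> 0) \<or> (\<forall>z\<in>K. affine_form u v w z \<le> 0)"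
    unfolding connected_iff_interval using nz by (meson imageI linear)
  then show ?thesis
  proof
    assume "\<forall>z\<in>K. affine_form u v w z \<ge> 0"
    then have "closure K \<subseteq> {z. affine_form u v w z \<ge> 0}"
      by (intro closure_minimal closed_Collect_le continuous_intros) auto
    then show ?thesis by auto
  next
    assume "\<forall>z\<in>K. affine_form u v w z \<le> 0"
    then have "closure K \<subseteq> {z. affine_form u v w z \<le> 0}"
      by (intro closure_minimal closed_Collect_le continuous_intros) auto
    then show ?thesis by auto
  qed
qed

section \<open>Openness of the complex and frontiers of components\<close>

lemma farey_complex_eq_interior:
  assumes "m \<ge> 1" "n \<ge> 1"
  shows "farey_complex m n = ({0<..<1} \<times> {0<..<1}) - \<Union> (farey_lines m n)"
proof -
  \<comment> \<open>The sides of the square lie on the lines x = 0, x = 1, y = 0 and y = 1, whose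
    normals are admissible because \<open>m\<close> and \<open>n\<close> are at least 1.\<close>
  have boundary: "z \<in> \<Union> (farey_lines m n)" if "z \<in> unit_square" "fst z = 0 \<or> fst z = 1 \<or> snd z = 0 \<or> snd z = 1" for z
  proof -
    have "\<exists>u v w. bounded_normal m n u v \<and> affine_form u v w z = 0"
      using that(2)
    proof (elim disjE)
      show ?thesis if "fst z = 0"
        using that assms by (intro exI[of _ 1] exI[of _ 0]) (auto simp: bounded_normal_def affine_form_def)
      show ?thesis if "fst z = 1"
        using that assms by (intro exI[of _ 1] exI[of _ 0] exI[of _ 1]) (auto simp: bounded_normal_def affine_form_def)
      show ?thesis if "snd z = 0"
        using that assms by (intro exI[of _ 0] exI[of _ 1] exI[of _ 0]) (auto simp: bounded_normal_def affine_form_def)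
      show ?thesis if "snd z = 1"
        using that assms by (intro exI[of _ 0] exI[of _ 1] exI[of _ 1]) (auto simp: bounded_normal_def affine_form_def)
    qed
    then show ?thesis
      using line_eq_in_farey_lines[OF _ that(1)] unfolding line_eq_affine_form by blast
  qed
  have "fst z \<in> {0<..<1} \<and> snd z \<in> {0<..<1}" if "z \<in> farey_complex m n" for z
  proof -
    have "z \<in> unit_square" "z \<notin> \<Union> (farey_lines m n)"
      using that by (simp_all add: farey_complex_def)
    moreover from this have "\<not> (fst z = 0 \<or> fst z = 1 \<or> snd z = 0 \<or> snd z = 1)"
      using boundary by blast
    ultimately show ?thesis
      by (auto simp: unit_square_def)
  qed
  moreover have "{0<..<1} \<times> {0<..<1} \<subseteq> unit_square"
    by (auto simp: unit_square_def)
  moreover have "z \<in> {0<..<1} \<times> {0<..<1} \<longleftrightarrow> fst z \<in> {0<..<1} \<and> snd z \<in> {0<..<1}" for z :: plane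
    by (simp add: mem_Times_iff)
  ultimately show ?thesis
    unfolding farey_complex_def by blast
qed

lemma open_farey_complex:
  assumes "m \<ge> 1" "n \<ge> 1"
  shows "open (farey_complex m n)"
  unfolding farey_complex_eq_interior[OF assms]
proof (intro open_Diff open_Times closed_Union finite_farey_lines)
  show "\<forall>L\<in>farey_lines m n. closed L"
    using closed_line_eq by (auto elim!: farey_linesE)
qed auto

lemma frontier_component_subset_lines:
  assumes "m \<ge> 1" "n \<ge> 1" and K: "K \<in> components (farey_complex m n)"
  shows "frontier K \<subseteq> \<Union> (farey_lines m n)"
proof
  fix z assume z: "z \<in> frontier K"
  have "open K"
    using open_components[OF open_farey_complex[OF assms(1,2)] K] .
  then have zK: "z \<in> closure K" "z \<notin> K"
    using z by (auto simp: frontier_def interior_open)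
  have "K \<subseteq> unit_square"
    using in_components_subset[OF K] by (auto simp: farey_complex_def)
  moreover have "closed unit_square"
    unfolding unit_square_def by (intro closed_Times) auto
  ultimately have "z \<in> unit_square"
    using closure_minimal zK by blast
  \<comment> \<open>A component is closed relative to the complex, so a point of
    \<open>closure K\<close> that belonged to the complex would belong to \<open>K\<close>.\<close>
  moreover have "z \<notin> farey_complex m n"
    using closedin_component[OF K] zK
    by (metis closedin_limpt closure_def UnE mem_Collect_eq)
  ultimately show "z \<in> \<Union> (farey_lines m n)"
    by (auto simp: farey_complex_def)
qed

section \<open>Lines that carry a segment\<close>

lemma affine_form_segment:
  "affine_form u v w ((1 - t) *\<^sub>R a + t *\<^sub>R b) = (1 - t) * affine_form u v w a + t * affine_form u v w b"
  by (simp add: affine_form_def algebra_simps)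

text \<open>Pigeonhole: the segment is infinite and the lines are finitely many, so one line
  contains two distinct points of it. A form that vanishes at two parameters of the segment vanishes
  at both ends.\<close>

lemma segment_in_finite_lines:
  assumes "a \<noteq> b" and sub: "closed_segment a b \<subseteq> \<Union> (farey_lines m n)"
  obtains u v w where "bounded_normal m n u v" "affine_form u v w a = 0" "affine_form u v w b = 0"
proof -
  have "infinite (closed_segment a b)"
    using assms(1) by (simp add: finite_closed_segment)
  moreover have "closed_segment a b = (\<Union>L\<in>farey_lines m n. L \<inter> closed_segment a b)"
    using sub by auto
  ultimately obtain L where L: "L \<in> farey_lines m n" "infinite (L \<inter> closed_segment a b)"
    using finite_farey_lines[of m n] by (metis finite_UN)
  from L(2) obtain x where x: "x \<in> L" "x \<in> closed_segment a b"
    using infinite_imp_nonempty by blast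
  have "infinite ((L \<inter> closed_segment a b) - {x})"
    using L(2) by simp
  then obtain y where y: "y \<in> L" "y \<in> closed_segment a b" "y \<noteq> x"
    using infinite_imp_nonempty by blast
  obtain u v w where uvw: "bounded_normal m n u v" "L = line_eq u v w"
    using L(1) by (rule farey_linesE)
  obtain s t where st: "x = (1 - s) *\<^sub>R a + s *\<^sub>R b" "y = (1 - t) *\<^sub>R a + t *\<^sub>R b"
    using x y by (auto simp: in_segment)
  define \<alpha> \<beta> where "\<alpha> = affine_form u v w a" and "\<beta> = affine_form u v w b"
  have "s \<noteq> t"
    using y(3) st by auto
  have e: "(1 - s) * \<alpha> + s * \<beta> = 0" "(1 - t) * \<alpha> + t * \<beta> = 0"
    using x(1) y(1) unfolding uvw(2) line_eq_affine_form st \<alpha>_def \<beta>_def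
    by (simp_all add: affine_form_segment)
  have "(t - s) * (\<beta> - \<alpha>) = 0"
    using e by (simp add: algebra_simps)
  then have "\<beta> = \<alpha>"
    using \<open>s \<noteq> t\<close> by simp
  moreover from this have "\<alpha> = 0"
    using e(1) by (simp add: algebra_simps)
  ultimately show thesis
    using that uvw(1) unfolding \<alpha>_def \<beta>_def by simp
qed

section \<open>Determinants in a convex polygonal family\<close>

lemma CPD_vertex_left_of_side:
  assumes "CPD N A" "0 \<le> p" "p < N" "1 \<le> q" "q < N" "q \<noteq> p" "q \<noteq> p + 1"
  shows "det2 (A (p + 1) - A p) (A q - A p) > 0"
  using assms by (auto simp: CPD_def)

text \<open>Both sides are twice the signed area of the triangle, which a cyclic shift of its
  vertices preserves.\<close>

lemma det2_rotate: "det2 (b - a) (c - a) = det2 (c - b) (a - b)"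
  by (simp add: det2_def algebra_simps)

lemma CPD_consecutive_sides:
  assumes C: "CPD N A" and p: "0 \<le> p" "p < N"
  shows "det2 (A (p + 1) - A p) (A (p + 2) - A (p + 1)) > 0"
proof -
  have N: "N \<ge> 3" and per: "\<And>p. A (p + N) = A p"
    using C by (auto simp: CPD_def)
  have *: "det2 (b - a) (c - b) = det2 (b - a) (c - a)" for a b c
    by (simp add: det2_def algebra_simps)
  consider "p + 2 < N" | "p + 2 = N" | "p + 1 = N"
    using p by linarith
  then have "det2 (A (p + 1) - A p) (A (p + 2) - A p) > 0"
  proof cases
    case 1
    then show ?thesis
      using C p by (intro CPD_vertex_left_of_side) auto
  next
    \<comment> \<open>Here \<open>A (p + 2)\<close> is \<open>A N = A 0\<close>, and index 0 is
      outside the range of \<open>q\<close> in \<open>CPD\<close>. Positivity is taken instead from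
      the next side, seen from the vertex \<open>A p\<close>, and then rotated.\<close>
    case 2
    then have "det2 (A (p + 1 + 1) - A (p + 1)) (A p - A (p + 1)) > 0"
      using C p N by (intro CPD_vertex_left_of_side) auto
    then show ?thesis
      by (simp add: det2_rotate[of "A (p + 1)"] add.commute[of 2])
  next
    case 3
    then have "det2 (A (p + 1) - A p) (A 1 - A p) > 0"
      using C p N by (intro CPD_vertex_left_of_side) auto
    moreover have "A (p + 2) = A 1"
      using per[of 1] by (simp add: add.commute flip: 3)
    ultimately show ?thesis
      by simp
  qed
  then show ?thesis
    by (simp add: *)
qed

text \<open>If the sides are adjacent, \<open>A q\<close> is an end of side \<open>p\<close> and the
  contradiction comes from \<open>A (q + 1)\<close>; otherwise it comes from \<open>A q\<close>. The
  order \<open>p < q\<close> keeps \<open>q\<close> in the range that \<open>CPD\<close>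
  covers.\<close>

lemma CPD_sides_not_collinear:
  assumes C: "CPD N A" and pq: "0 \<le> p" "p < q" "q < N"
    and "det2 (A (p + 1) - A p) (A q - A p) = 0" "det2 (A (p + 1) - A p) (A (q + 1) - A p) = 0"
  shows "False"
proof (cases "q = p + 1")
  case True
  then show False
    using assms(6) CPD_consecutive_sides[OF C, of p] pq
    by (simp add: det2_def algebra_simps)
next
  case False
  then show False
    using CPD_vertex_left_of_side[OF C, of p q] pq assms(5) by simp
qed

text \<open>Relative to \<open>a\<close>, both \<open>c\<close> and \<open>d\<close> are parallel to
  the nonzero vector \<open>b - a\<close>, hence to each other. This exchanges the roles of two
  sides once one is known to lie on the line of the other.\<close>

lemma collinear_sym:
  assumes "b \<noteq> a" "det2 (b - a) (c - a) = 0" "det2 (b - a) (d - a) = 0"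
  shows "det2 (d - c) (a - c) = 0" "det2 (d - c) (b - c) = 0"
proof -
  define x y where "x = fst b - fst a" and "y = snd b - snd a"
  have nz: "x \<noteq> 0 \<or> y \<noteq> 0"
    using assms(1) by (auto simp: x_def y_def prod_eq_iff)
  define c1 c2 d1 d2 where "c1 = fst c - fst a" and "c2 = snd c - snd a"
    and "d1 = fst d - fst a" and "d2 = snd d - snd a"
  have e: "x * c2 = y * c1" "x * d2 = y * d1"
    using assms(2,3) by (simp_all add: det2_def x_def y_def c1_def c2_def d1_def d2_def)
  have k: "c1 * d2 = c2 * d1"
  proof (cases "x = 0")
    case True
    then show ?thesis using e nz by simp
  next
    case False
    have "x * (c1 * d2) = x * (c2 * d1)" using e by algebra
    then show ?thesis using False by simp
  qed
  have "det2 (d - c) (a - c) = c1 * d2 - c2 * d1"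
    by (simp add: det2_def c1_def c2_def d1_def d2_def algebra_simps)
  then show "det2 (d - c) (a - c) = 0" using k by simp
  have "det2 (d - c) (b - c) = (c1 * d2 - c2 * d1) + (y * d1 - x * d2) + (x * c2 - y * c1)"
    by (simp add: det2_def c1_def c2_def d1_def d2_def x_def y_def algebra_simps)
  then show "det2 (d - c) (b - c) = 0" using k e by simp
qed

section \<open>Forms attached to the sides\<close>

lemma affine_form_eq_det2:
  assumes "b \<noteq> a" "affine_form u v w a = 0" "affine_form u v w b = 0"
  obtains c where "of_int u = - (c * snd (b - a))" "of_int v = c * fst (b - a)"
    "\<And>z. affine_form u v w z = c * det2 (b - a) (z - a)"
proof -
  define x y where "x = fst b - fst a" and "y = snd b - snd a"
  \<comment> \<open>The normal \<open>(u, v)\<close> is orthogonal to \<open>(x, y)\<close>, hence a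
    multiple of its quarter turn \<open>(-y, x)\<close>; the factor is read off from a nonzero
    coordinate.\<close>
  define c where "c = (if x \<noteq> 0 then of_int v / x else - (of_int u / y))"
  have nz: "x \<noteq> 0 \<or> y \<noteq> 0"
    using assms(1) by (auto simp: x_def y_def prod_eq_iff)
  have orth: "of_int u * x + of_int v * y = 0"
    using assms(2,3) by (simp add: affine_form_def x_def y_def algebra_simps)
  have u: "of_int u = - (c * y)" and v: "of_int v = c * x"
    using nz orth by (auto simp: c_def field_simps)
  have "affine_form u v w z = c * det2 (b - a) (z - a)" for z
  proof -
    have "affine_form u v w z = affine_form u v w z - affine_form u v w a"
      using assms(2) by simp
    also have "\<dots> = of_int u * (fst z - fst a) + of_int v * (snd z - snd a)"
      by (simp add: affine_form_def algebra_simps)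
    also have "\<dots> = c * det2 (b - a) (z - a)"
      unfolding u v by (simp add: det2_def x_def y_def algebra_simps)
    finally show ?thesis .
  qed
  then show thesis
    using that[of c] u v by (simp add: x_def y_def)
qed

lemma CPD_side_nonzero:
  assumes "CPD N A" "0 \<le> p" "p < N"
  shows "A (p + 1) \<noteq> A p"
  using CPD_consecutive_sides[OF assms] by (auto simp: det2_def)

text \<open>A Farey line carries the side, and its equation is negated if necessary to be
  nonnegative on the closure. Since \<open>c > 0\<close>, the quadrant of the side vector then
  determines the weak signs of \<open>u\<close> and \<open>v\<close>.\<close>

lemma side_form:
  assumes mn: "m \<ge> 1" "n \<ge> 1" and K: "K \<in> components (farey_complex m n)" and C: "CPD N A"
    and fr: "frontier K = (\<Union>k\<in>{0..N-1}. closed_segment (A k) (A (k + 1)))"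
    and p: "0 \<le> p" "p < N"
  obtains u v w c where "bounded_normal m n u v" "c > 0"
    "of_int u = - (c * snd (A (p + 1) - A p))" "of_int v = c * fst (A (p + 1) - A p)"
    "\<And>z. affine_form u v w z = c * det2 (A (p + 1) - A p) (z - A p)"
    "\<And>z. z \<in> closure K \<Longrightarrow> affine_form u v w z \<ge> 0"
proof -
  have ne: "A (p + 1) \<noteq> A p"
    using CPD_side_nonzero[OF C p] .
  have "closed_segment (A p) (A (p + 1)) \<subseteq> \<Union> (farey_lines m n)"
    using frontier_component_subset_lines[OF mn K] p unfolding fr by fastforce
  then obtain u0 v0 w0 where 0: "bounded_normal m n u0 v0" "affine_form u0 v0 w0 (A p) = 0"
      "affine_form u0 v0 w0 (A (p + 1)) = 0"
    using segment_in_finite_lines ne by metis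
  have neg: "affine_form (-u) (-v) (-w) z = - affine_form u v w z" for u v w z
    by (simp add: affine_form_def)
  have "\<exists>u v w. bounded_normal m n u v \<and> affine_form u v w (A p) = 0 \<and>
      affine_form u v w (A (p + 1)) = 0 \<and> (\<forall>z\<in>closure K. affine_form u v w z \<ge> 0)"
    using affine_form_sign_on_closure[OF K 0(1), of w0]
  proof
    assume "\<forall>z\<in>closure K. affine_form u0 v0 w0 z \<ge> 0"
    then show ?thesis using 0 by blast
  next
    assume "\<forall>z\<in>closure K. affine_form u0 v0 w0 z \<le> 0"
    then show ?thesis
      using 0 by (intro exI[of _ "-u0"] exI[of _ "-v0"] exI[of _ "-w0"])
        (auto simp: neg bounded_normal_def)
  qed
  then obtain u v w where uv: "bounded_normal m n u v" and a: "affine_form u v w (A p) = 0"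
      "affine_form u v w (A (p + 1)) = 0"
      and pos: "\<And>z. z \<in> closure K \<Longrightarrow> affine_form u v w z \<ge> 0"
    by blast
  obtain c where c: "of_int u = - (c * snd (A (p + 1) - A p))" "of_int v = c * fst (A (p + 1) - A p)"
    "\<And>z. affine_form u v w z = c * det2 (A (p + 1) - A p) (z - A p)"
    using affine_form_eq_det2[OF ne a] by blast
  have per: "A (k + N) = A k" for k
    using C by (auto simp: CPD_def)
  \<comment> \<open>This vertex fixes the sign of \<open>c\<close>: the form is nonnegative there
    and the determinant is positive. For \<open>p + 1 = N\<close> it is the end \<open>A 1\<close>
    of the segment with index 0.\<close>
  have "A (p + 2) \<in> frontier K"
  proof (cases "p + 1 = N")
    case True
    have "A (p + 2) \<in> closed_segment (A 0) (A (0 + 1))"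
      using per[of 1] True by (simp add: add.commute flip: True)
    then show ?thesis unfolding fr using p by (intro UN_I[of 0]) auto
  next
    case False
    have "A (p + 2) \<in> closed_segment (A (p + 1)) (A (p + 1 + 1))"
      by (simp add: add.assoc)
    then show ?thesis unfolding fr using p False by (intro UN_I[of "p + 1"]) auto
  qed
  then have "c * det2 (A (p + 1) - A p) (A (p + 2) - A p) \<ge> 0"
    using pos c(3) by (simp add: frontier_def)
  moreover have "det2 (A (p + 1) - A p) (A (p + 2) - A p) > 0"
    using CPD_consecutive_sides[OF C p] by (simp add: det2_def algebra_simps)
  ultimately have "c \<ge> 0"
    by (simp add: zero_le_mult_iff)
  moreover have "c \<noteq> 0"
    using uv c(1,2) by (auto simp: bounded_normal_def)
  ultimately show thesis
    using that[OF uv _ c pos] by simp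
qed

section \<open>Two sides in a common quadrant\<close>

lemma side_forms_ordered_imp_collinear:
  assumes "p \<in> {0..<N}" "CPD N A"
    and fr: "frontier K = (\<Union>k\<in>{0..N-1}. closed_segment (A k) (A (k + 1)))"
    and f: "\<And>z. f z = c * det2 (A (p + 1) - A p) (z - A p)"
    and g: "c' > 0" "\<And>z. g z = c' * det2 (A (q + 1) - A q) (z - A q)"
    and nonneg: "\<And>z. z \<in> closure K \<Longrightarrow> 0 \<le> g z" "\<And>z. z \<in> closure K \<Longrightarrow> g z \<le> f z"
  shows "det2 (A (q + 1) - A q) (A p - A q) = 0" "det2 (A (q + 1) - A q) (A (p + 1) - A q) = 0"
proof -
  have "closed_segment (A p) (A (p + 1)) \<subseteq> closure K"
    using assms(1) fr unfolding frontier_def by fastforce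
  then have in_K: "A p \<in> closure K" "A (p + 1) \<in> closure K"
    by auto
  have "f (A p) = 0" "f (A (p + 1)) = 0"
    unfolding f by (simp_all add: det2_def)
  \<comment> \<open>Squeeze: \<open>g\<close> lies between 0 and \<open>f\<close> on the closure,
    and \<open>f\<close> vanishes at both ends of side \<open>p\<close>.\<close>
  then have "g (A p) = 0" "g (A (p + 1)) = 0"
    using nonneg in_K by (metis order.antisym)+
  then show "det2 (A (q + 1) - A q) (A p - A q) = 0" "det2 (A (q + 1) - A q) (A (p + 1) - A q) = 0"
    using g by simp_all
qed

text \<open>Integers of the same weak sign differ by at most the larger absolute value. The positive
  factors \<open>c\<close> and \<open>d\<close> carry the signs of side coordinates over to the
  coefficients.\<close>

lemma int_diff_same_sign_bounded:
  fixes a b :: int and x y c d :: real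
  assumes "of_int a = c * x" "of_int b = d * y" "c > 0" "d > 0"
    "x \<ge> 0 \<and> y \<ge> 0 \<or> x \<le> 0 \<and> y \<le> 0" "\<bar>a\<bar> \<le> k" "\<bar>b\<bar> \<le> k"
  shows "\<bar>a - b\<bar> \<le> k"
proof -
  have "of_int a \<ge> (0::real) \<and> of_int b \<ge> (0::real) \<or> of_int a \<le> (0::real) \<and> of_int b \<le> (0::real)"
    unfolding assms(1,2) using assms(3-5) by (auto simp: zero_le_mult_iff mult_le_0_iff)
  then show ?thesis
    using assms(6,7) by auto
qed

text \<open>The difference of the two side forms has constant weak sign on the closure, so one form
  dominates the other. The squeeze then puts both sides on one line, which a \<open>CPD\<close>
  forbids.\<close>

lemma sides_not_in_same_quadrant:
  assumes mn: "m \<ge> 1" "n \<ge> 1" and K: "K \<in> components (farey_complex m n)" and C: "CPD N A"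
    and fr: "frontier K = (\<Union>k\<in>{0..N-1}. closed_segment (A k) (A (k + 1)))"
    and pq: "0 \<le> p" "p < q" "q < N"
    and quad: "A (p + 1) - A p \<in> quadrant i" "A (q + 1) - A q \<in> quadrant i"
  shows False
proof -
  obtain u v w c where 1: "bounded_normal m n u v" "c > 0"
    "of_int u = - (c * snd (A (p + 1) - A p))" "of_int v = c * fst (A (p + 1) - A p)"
    "\<And>z. affine_form u v w z = c * det2 (A (p + 1) - A p) (z - A p)"
    "\<And>z. z \<in> closure K \<Longrightarrow> affine_form u v w z \<ge> 0"
    by (rule side_form[OF mn K C fr, of p]) (use pq in auto)
  obtain u' v' w' c' where 2: "bounded_normal m n u' v'" "c' > 0"
    "of_int u' = - (c' * snd (A (q + 1) - A q))" "of_int v' = c' * fst (A (q + 1) - A q)"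
    "\<And>z. affine_form u' v' w' z = c' * det2 (A (q + 1) - A q) (z - A q)"
    "\<And>z. z \<in> closure K \<Longrightarrow> affine_form u' v' w' z \<ge> 0"
    by (rule side_form[OF mn K C fr, of q]) (use pq in auto)
  have diff: "affine_form (u - u') (v - v') (w - w') z = affine_form u v w z - affine_form u' v' w' z" for z
    by (simp add: affine_form_def algebra_simps)
  define d d' where "d = A (p + 1) - A p" and "d' = A (q + 1) - A q"
  have "- snd d \<ge> 0 \<and> - snd d' \<ge> 0 \<or> - snd d \<le> 0 \<and> - snd d' \<le> 0"
      "fst d \<ge> 0 \<and> fst d' \<ge> 0 \<or> fst d \<le> 0 \<and> fst d' \<le> 0"
    using quad unfolding d_def [symmetric] d'_def [symmetric] by (auto simp: quadrant_def)
  moreover have "of_int u = c * (- snd d)" "of_int u' = c' * (- snd d')"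
      "of_int v = c * fst d" "of_int v' = c' * fst d'"
    using 1(3,4) 2(3,4) unfolding d_def [symmetric] d'_def [symmetric] by simp_all
  moreover have "\<bar>u\<bar> \<le> m" "\<bar>u'\<bar> \<le> m" "\<bar>v\<bar> \<le> n" "\<bar>v'\<bar> \<le> n"
    using 1(1) 2(1) by (simp_all add: bounded_normal_def)
  ultimately have "\<bar>u - u'\<bar> \<le> m" "\<bar>v - v'\<bar> \<le> n"
    using int_diff_same_sign_bounded[OF _ _ 1(2) 2(2)] by meson+
  then have "u = u' \<and> v = v' \<or> bounded_normal m n (u - u') (v - v')"
    by (auto simp: bounded_normal_def)
  then have "(\<forall>z\<in>closure K. affine_form (u - u') (v - v') (w - w') z \<ge> 0) \<or>
      (\<forall>z\<in>closure K. affine_form (u - u') (v - v') (w - w') z \<le> 0)"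
  proof
    \<comment> \<open>With equal normals the difference is the constant \<open>w' - w\<close>, which
      also has a fixed sign.\<close>
    assume "u = u' \<and> v = v'"
    then show ?thesis
      by (cases "w \<le> w'") (auto simp: affine_form_def)
  next
    assume "bounded_normal m n (u - u') (v - v')"
    then show ?thesis
      using affine_form_sign_on_closure[OF K] by blast
  qed
  then have "(\<forall>z\<in>closure K. affine_form u' v' w' z \<le> affine_form u v w z) \<or>
      (\<forall>z\<in>closure K. affine_form u v w z \<le> affine_form u' v' w' z)"
    by (simp add: diff)
  then have "det2 (A (p + 1) - A p) (A q - A p) = 0 \<and> det2 (A (p + 1) - A p) (A (q + 1) - A p) = 0"
  proof
    assume le: "\<forall>z\<in>closure K. affine_form u' v' w' z \<le> affine_form u v w z"
    have "det2 (A (q + 1) - A q) (A p - A q) = 0" "det2 (A (q + 1) - A q) (A (p + 1) - A q) = 0"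
      by (rule side_forms_ordered_imp_collinear[OF _ C fr 1(5) 2(2,5,6)]; use le pq in auto)+
    \<comment> \<open>The squeeze placed side \<open>p\<close> on the line of side \<open>q\<close>;
      the roles are exchanged to match the order \<open>p < q\<close>.\<close>
    then show ?thesis
      using collinear_sym CPD_side_nonzero[OF C, of q] pq by auto
  next
    assume le: "\<forall>z\<in>closure K. affine_form u v w z \<le> affine_form u' v' w' z"
    have "det2 (A (p + 1) - A p) (A q - A p) = 0" "det2 (A (p + 1) - A p) (A (q + 1) - A p) = 0"
      by (rule side_forms_ordered_imp_collinear[OF _ C fr 2(5) 1(2,5,6)]; use le pq in auto)+
    then show ?thesis by simp
  qed
  then show False
    using CPD_sides_not_collinear[OF C pq] by blast
qed

section \<open>Quadrant labels and their cyclic order\<close>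

lemma quadrant_cases:
  assumes "V \<noteq> 0"
  obtains i where "i \<in> {1, 2, 3, 4}" "V \<in> quadrant i"
proof -
  have "V \<in> quadrant 1 \<or> V \<in> quadrant 2 \<or> V \<in> quadrant 3 \<or> V \<in> quadrant 4"
    using assms by (cases V) (auto simp: quadrant_def zero_prod_def)
  then show thesis
    using that by blast
qed

lemma quadrant_range: "V \<in> quadrant i \<Longrightarrow> i = 1 \<or> i = 2 \<or> i = 3 \<or> i = 4"
  by (auto simp: quadrant_def)

text \<open>Among the labels 1 to 4, the opposite pairs are exactly those at distance 2, so
  opposition becomes arithmetic on labels.\<close>

lemma opposite_quadrants_iff:
  "opposite_quadrants V W \<longleftrightarrow> (\<exists>i j. V \<in> quadrant i \<and> W \<in> quadrant j \<and> \<bar>i - j\<bar> = 2)"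
proof
  assume "opposite_quadrants V W"
  then show "\<exists>i j. V \<in> quadrant i \<and> W \<in> quadrant j \<and> \<bar>i - j\<bar> = 2"
    unfolding opposite_quadrants_def by force
next
  assume "\<exists>i j. V \<in> quadrant i \<and> W \<in> quadrant j \<and> \<bar>i - j\<bar> = 2"
  then obtain i j where "V \<in> quadrant i" "W \<in> quadrant j" "\<bar>i - j\<bar> = 2"
    by blast
  then show "opposite_quadrants V W"
    using quadrant_range[of V i] quadrant_range[of W j] unfolding opposite_quadrants_def by auto
qed

text \<open>The listed pairs go back by one quadrant in the cyclic order; there the signs of the
  coordinates make the determinant at most 0.\<close>

lemma det2_pos_quadrant_step:
  assumes "V \<in> quadrant i" "W \<in> quadrant j" "det2 V W > 0"
  shows "(i, j) \<notin> {(1, 4), (2, 1), (3, 2), (4, 3)}"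
proof
  have *: "fst V * snd W \<le> snd V * fst W \<Longrightarrow> False"
    using assms(3) by (simp add: det2_def)
  assume "(i, j) \<in> {(1, 4), (2, 1), (3, 2), (4, 3)}"
  then show False
    using assms(1,2)
    by (intro *, elim insertE emptyE; simp add: quadrant_def)
      (smt (verit) mult_nonneg_nonneg mult_nonneg_nonpos mult_nonpos_nonneg mult_nonpos_nonpos)+
qed

text \<open>Of the six cyclic orders of four labels, only the increasing one has no step back by
  one.\<close>

lemma quadrant_cycle:
  fixes a b c d :: int
  assumes "a \<in> {1,2,3,4}" "b \<in> {1,2,3,4}" "c \<in> {1,2,3,4}" "d \<in> {1,2,3,4}"
    and "a \<noteq> b" "a \<noteq> c" "a \<noteq> d" "b \<noteq> c" "b \<noteq> d" "c \<noteq> d"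
    and "(a, b) \<notin> {(1, 4), (2, 1), (3, 2), (4, 3)}" "(b, c) \<notin> {(1, 4), (2, 1), (3, 2), (4, 3)}"
      "(c, d) \<notin> {(1, 4), (2, 1), (3, 2), (4, 3)}" "(d, a) \<notin> {(1, 4), (2, 1), (3, 2), (4, 3)}"
  shows "(a, b, c, d) \<in> {(1,2,3,4), (2,3,4,1), (3,4,1,2), (4,1,2,3)}"
  using assms unfolding insert_iff empty_iff prod.inject by (smt (verit))

section \<open>Counting the sides and ordering their quadrants\<close>

theorem mainTheorem3:
  fixes m n N :: int and K :: "plane set" and A :: "int \<Rightarrow> plane"
  assumes "m \<ge> 1" and "n \<ge> 1"
    and "K \<in> components (farey_complex m n)"
    and "CPD N A"
    and "frontier K = (\<Union>k\<in>{0..N-1}. closed_segment (A k) (A (k + 1)))"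
  shows "((\<exists>k. opposite_quadrants (A k - A (k - 1)) (A (k + 1) - A k)) \<longrightarrow> N = 3) \<and>
         (\<not> (\<exists>k. opposite_quadrants (A k - A (k - 1)) (A (k + 1) - A k)) \<longrightarrow>
            N = 4 \<and> (\<exists>p. \<forall>i\<in>{1, 2, 3, 4}. A (p + i) - A (p + i - 1) \<in> quadrant i))"
proof -
  have N3: "N \<ge> 3" and per: "\<And>k. A (k + N) = A k"
    using assms(4) by (auto simp: CPD_def)
  define e where "e k = A (k + 1) - A k" for k
  have e_per: "e (k + N) = e k" for k
    unfolding e_def using per[of k] per[of "k + 1"] by (simp add: algebra_simps)
  have uniq: "p = q" if "p \<in> {0..<N}" "q \<in> {0..<N}" "e p \<in> quadrant i" "e q \<in> quadrant i" for p q i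
    using sides_not_in_same_quadrant[OF assms, of p q i]
      sides_not_in_same_quadrant[OF assms, of q p i] that
    unfolding e_def by (cases p q rule: linorder_cases) auto
  have "\<exists>i\<in>{1,2,3,4}. e p \<in> quadrant i" if "p \<in> {0..<N}" for p
    using CPD_side_nonzero[OF assms(4), of p] that quadrant_cases[of "e p"]
    unfolding e_def by (metis atLeastLessThan_iff eq_iff_diff_eq_0)
  \<comment> \<open>A side on an axis has two possible labels; \<open>f\<close> chooses one.
    Injectivity of \<open>f\<close> then gives \<open>N \<le> 4\<close>.\<close>
  then obtain f where f: "\<And>p. p \<in> {0..<N} \<Longrightarrow> f p \<in> {1,2,3,4} \<and> e p \<in> quadrant (f p)"
    by metis
  have inj: "inj_on f {0..<N}"
    using f uniq by (metis inj_onI)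
  have "card {0..<N} \<le> card {1, 2, 3, 4::int}"
    using inj f by (intro card_inj_on_le) blast+
  then have "N = 3 \<or> N = 4"
    using N3 by auto
  then show ?thesis
  proof
    assume N: "N = 3"
    have "f 0 \<noteq> f 1" "f 1 \<noteq> f 2" "f 2 \<noteq> f 0"
      using inj unfolding N by (auto dest: inj_onD)
    \<comment> \<open>Three distinct labels out of four contain an opposite pair, and any two sides
      of a triangle are cyclically consecutive. Hence \<open>N = 3\<close> always falls under the
      first alternative.\<close>
    then have "\<bar>f 0 - f 1\<bar> = 2 \<or> \<bar>f 1 - f 2\<bar> = 2 \<or> \<bar>f 2 - f 0\<bar> = 2"
      using f[of 0] f[of 1] f[of 2] N by auto
    moreover have "e 3 = e 0"
      using e_per[of 0] N by simp
    ultimately have "opposite_quadrants (e 0) (e 1) \<or> opposite_quadrants (e 1) (e 2) \<or>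
        opposite_quadrants (e 2) (e 3)"
      unfolding opposite_quadrants_iff using f[of 0] f[of 1] f[of 2] N by auto
    then have "opposite_quadrants (e (1 - 1)) (e 1) \<or> opposite_quadrants (e (2 - 1)) (e 2) \<or>
        opposite_quadrants (e (3 - 1)) (e 3)"
      by simp
    then have "\<exists>k. opposite_quadrants (e (k - 1)) (e k)"
      by blast
    then show ?thesis
      using N by (auto simp: e_def)
  next
    assume N: "N = 4"
    have e4: "e 4 = e 0"
      using e_per[of 0] N by simp
    have ne: "f 0 \<noteq> f 1" "f 0 \<noteq> f 2" "f 0 \<noteq> f 3" "f 1 \<noteq> f 2" "f 1 \<noteq> f 3" "f 2 \<noteq> f 3"
      using inj unfolding N by (auto dest: inj_onD)
    have fr: "f 0 \<in> {1,2,3,4}" "f 1 \<in> {1,2,3,4}" "f 2 \<in> {1,2,3,4}" "f 3 \<in> {1,2,3,4}"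
      and fe: "e 0 \<in> quadrant (f 0)" "e 1 \<in> quadrant (f 1)" "e 2 \<in> quadrant (f 2)" "e 3 \<in> quadrant (f 3)"
      using f N by auto
    have det: "det2 (e 0) (e 1) > 0" "det2 (e 1) (e 2) > 0" "det2 (e 2) (e 3) > 0" "det2 (e 3) (e 0) > 0"
      using CPD_consecutive_sides[OF assms(4), of 0] CPD_consecutive_sides[OF assms(4), of 1]
        CPD_consecutive_sides[OF assms(4), of 2] CPD_consecutive_sides[OF assms(4), of 3] N e4
      by (auto simp: e_def)
    have step: "(f 0, f 1) \<notin> {(1, 4), (2, 1), (3, 2), (4, 3)}" "(f 1, f 2) \<notin> {(1, 4), (2, 1), (3, 2), (4, 3)}"
      "(f 2, f 3) \<notin> {(1, 4), (2, 1), (3, 2), (4, 3)}" "(f 3, f 0) \<notin> {(1, 4), (2, 1), (3, 2), (4, 3)}"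
      using det2_pos_quadrant_step fe det by blast+
    have cyc: "(f 0, f 1, f 2, f 3) \<in> {(1,2,3,4), (2,3,4,1), (3,4,1,2), (4,1,2,3)}"
      by (rule quadrant_cycle[OF fr ne step])
    have surj: "i \<in> {f 0, f 1, f 2, f 3}" if "V \<in> quadrant i" for V i
      using quadrant_range[OF that] cyc by auto
    \<comment> \<open>All four labels are taken, so a second label of side \<open>p\<close> would be
      shared with another side, against \<open>uniq\<close>. Thus opposition of sides can be tested
      on \<open>f\<close> alone.\<close>
    have only: "i = f p" if "p \<in> {0..<4}" "e p \<in> quadrant i" for p i
    proof -
      have "{0..<4} = {0, 1, 2, 3::int}"
        by auto
      then have "i \<in> f ` {0..<4}"
        using surj[OF that(2)] by simp
      then obtain q where "q \<in> {0..<4}" "i = f q"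
        by blast
      then show ?thesis
        using uniq[of p q i] that f N by auto
    qed
    have no_opp: "\<not> opposite_quadrants (A k - A (k - 1)) (A (k + 1) - A k)" for k
    proof
      assume opp: "opposite_quadrants (A k - A (k - 1)) (A (k + 1) - A k)"
      \<comment> \<open>The index \<open>k\<close> ranges over all integers: a nonnegative quotient
        is handled by shifting up from \<open>k mod 4\<close>, a negative one by shifting up from
        \<open>k\<close>.\<close>
      have mod: "e k = e (k mod 4)" for k
      proof -
        have "e (j + int r * 4) = e j" for j r
        proof (induction r)
          case (Suc r)
          then show ?case using e_per[of "j + int r * 4"] N by (simp add: algebra_simps)
        qed simp
        note shift = this
        show ?thesis
        proof (cases "k div 4 \<ge> 0")
          case True
          then have "k mod 4 + int (nat (k div 4)) * 4 = k"
            by simp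
          then show ?thesis using shift by metis
        next
          case False
          then have "k mod 4 = k + int (nat (- (k div 4))) * 4"
            by (simp add: minus_div_mult_eq_mod [symmetric])
          then show ?thesis using shift by metis
        qed
      qed
      have "opposite_quadrants (e ((k - 1) mod 4)) (e (k mod 4))"
        using opp mod[of "k - 1"] mod[of k] by (simp add: e_def)
      moreover have "k mod 4 = 0 \<and> (k - 1) mod 4 = 3 \<or> k mod 4 = 1 \<and> (k - 1) mod 4 = 0 \<or>
          k mod 4 = 2 \<and> (k - 1) mod 4 = 1 \<or> k mod 4 = 3 \<and> (k - 1) mod 4 = 2"
        by presburger
      ultimately have "opposite_quadrants (e 3) (e 0) \<or> opposite_quadrants (e 0) (e 1) \<or>
          opposite_quadrants (e 1) (e 2) \<or> opposite_quadrants (e 2) (e 3)"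
        by auto
      \<comment> \<open>In the cyclic order 1, 2, 3, 4 neighbouring labels differ by 1, or by 3 at
        the wrap-around, never by 2.\<close>
      then have "\<bar>f 3 - f 0\<bar> = 2 \<or> \<bar>f 0 - f 1\<bar> = 2 \<or> \<bar>f 1 - f 2\<bar> = 2 \<or> \<bar>f 2 - f 3\<bar> = 2"
        unfolding opposite_quadrants_iff using only[of 0] only[of 1] only[of 2] only[of 3] by auto
      then show False
        using cyc by auto
    qed
    have e_shift: "e 5 = e 1" "e 6 = e 2"
      using e_per[of 1] e_per[of 2] N by auto
    have "\<exists>p. e p \<in> quadrant 1 \<and> e (p + 1) \<in> quadrant 2 \<and> e (p + 2) \<in> quadrant 3 \<and> e (p + 3) \<in> quadrant 4"
    proof -
      \<comment> \<open>The required \<open>p\<close> is the index of the side labelled 1; indices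
        then run up to 6, which \<open>e4\<close> and \<open>e_shift\<close> reduce.\<close>
      consider "f 0 = 1" | "f 1 = 1" | "f 2 = 1" | "f 3 = 1"
        using cyc by auto
      then show ?thesis
      proof cases
        case 1 then show ?thesis using cyc fe e4 e_shift by (intro exI[of _ 0]) auto
      next
        case 2 then show ?thesis using cyc fe e4 e_shift by (intro exI[of _ 1]) auto
      next
        case 3 then show ?thesis using cyc fe e4 e_shift by (intro exI[of _ 2]) auto
      next
        case 4 then show ?thesis using cyc fe e4 e_shift by (intro exI[of _ 3]) auto
      qed
    qed
    then obtain p where "e p \<in> quadrant 1" "e (p + 1) \<in> quadrant 2" "e (p + 2) \<in> quadrant 3" "e (p + 3) \<in> quadrant 4"
      by blast
    then have "\<forall>i\<in>{1, 2, 3, 4}. A (p + i) - A (p + i - 1) \<in> quadrant i"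
      by (auto simp: e_def add.commute)
    then show ?thesis
      using N no_opp by blast
  qed
qed

end
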